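(* Let $c>2$ be a real number with $c\notin\mathbb{N}$, and let $\beta(c)>0$ be a constant such that for all positive integers $N$ and $q$ and every primitive Dirichlet character $\chi$ modulo $q$, $$\sum_{N/2<n\le N}\chi(\lfloor n^c\rfloor)\ll q^{1/2}N^{1-\beta(c)},$$ with an implied constant depending only on $c$. Then, as $N\to\infty$, uniformly in the positive integer $s$, $$Q_c(s;N)\ll N^{1-\beta(c)/2+o(1)};$$ that is, for every $\varepsilon>0$ there is $C=C(c,\varepsilon)$ such that $Q_c(s;N)\le C N^{1-\beta(c)/2+\varepsilon}$ for all positive integers $s,N$.
   Context: For a real $c>1$ and positive integers $s,N$, $Q_c(s;N)$ denotes the number of integers $n$ with $1\le n\le N$ such that $\lfloor n^c\rfloor=sm^2$ for some integer $m$; here $\lfloor z\rfloor$ is the integer part of $z$. *)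

theory Defs
  imports Complex_Main "HOL-Number_Theory.Cong"
begin

text \<open>The three conditions together force \<open>\<chi> 1 = 1\<close>.\<close>

definition dirichlet_character :: "nat \<Rightarrow> (int \<Rightarrow> complex) \<Rightarrow> bool" where
  "dirichlet_character q \<chi> \<longleftrightarrow>
     q > 0 \<and>
     (\<forall>a b. \<chi> (a * b) = \<chi> a * \<chi> b) \<and>
     (\<forall>a b. [a = b] (mod int q) \<longrightarrow> \<chi> a = \<chi> b) \<and>
     (\<forall>a. \<chi> a \<noteq> 0 \<longleftrightarrow> coprime a (int q))"

definition induced_from :: "nat \<Rightarrow> nat \<Rightarrow> (int \<Rightarrow> complex) \<Rightarrow> bool" where
  "induced_from d q \<chi> \<longleftrightarrow>
     d dvd q \<and>
     (\<exists>\<psi>. dirichlet_character d \<psi> \<and> (\<forall>a. coprime a (int q) \<longrightarrow> \<chi> a = \<psi> a))"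

text \<open>With this (usual) convention the constant character modulo 1 is primitive. Its sums
  over \<open>N/2 < n \<le> N\<close> have order \<open>N\<close>, so a hypothesis asking for power-saving bounds on
  character sums has to be restricted to moduli \<open>q > 1\<close> in order not to be unsatisfiable.\<close>

definition primitive_dirichlet_character :: "nat \<Rightarrow> (int \<Rightarrow> complex) \<Rightarrow> bool" where
  "primitive_dirichlet_character q \<chi> \<longleftrightarrow>
     dirichlet_character q \<chi> \<and> \<not> (\<exists>d<q. induced_from d q \<chi>)"

definition Q_count :: "real \<Rightarrow> nat \<Rightarrow> nat \<Rightarrow> nat" where
  "Q_count c s N = card {n \<in> {1..N}. \<exists>m::int. \<lfloor>real n powr c\<rfloor> = int s * m\<^sup>2}"

end

theory Submission
  imports Defs "HOL-Number_Theory.Number_Theory" "HOL-Real_Asymp.Real_Asymp"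
begin

text \<open>
  The proof is Heath-Brown's square sieve. Let \<open>N/2 < n \<le> N\<close> and \<open>a = \<lfloor>n\<^sup>c\<rfloor> = s m\<^sup>2\<close>. Then
  \<open>s a = (s m)\<^sup>2\<close>, so the Legendre symbol \<open>(s a / p)\<close> is 1 for every prime \<open>p\<close>
  outside the \<open>O(log N)\<close> prime divisors of \<open>s m\<close>. Summing \<open>(\<Sum>p\<in>P. (s a / p))\<^sup>2\<close> over
  all \<open>n\<close>, where \<open>P\<close> is the set of odd primes up to \<open>z = N\<^bsup>\<beta>/2\<^esup>\<close>, and expanding the
  square leaves a diagonal of size \<open>card P * N\<close> and off-diagonal sums of the primitive
  character \<open>(\<cdot> / p q)\<close>, in which \<open>s\<close> contributes only a factor of absolute value at
  most 1. Hence the number of such \<open>n\<close> is \<open>O(N / card P + z N\<^bsup>1-\<beta>\<^esup>)\<close>.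

  The dyadic pieces add up only if the exponent \<open>1 - \<beta>/2 + \<epsilon>\<close> is positive. This holds
  because the hypothesis forces \<open>\<beta> \<le> 1\<close>: for \<open>\<beta> > 1\<close> the integer-valued Legendre
  sums over \<open>(N, 2N]\<close> and \<open>(N, 2N+1]\<close> would both vanish for all odd primes \<open>p\<close> up to a
  power of \<open>N\<close>, so \<open>\<lfloor>(2N+1)\<^sup>c\<rfloor>\<close> would be divisible by too many primes.
\<close>

subsection \<open>A Chebyshev lower bound for the number of primes\<close>

text \<open>
  The Leibniz triangle recurrence \<open>L(n, m + 1) = L(n - 1, m) - L(n, m)\<close> for
  \<open>L(n, m) = 1 / (m * (n choose m))\<close>, cleared of denominators: \<open>x = (n choose m)\<close>,
  \<open>d = n - m\<close>, and \<open>a\<close>, \<open>b\<close> are the multiples of \<open>L(n, m)\<close>, \<open>L(n - 1, m)\<close> by \<open>l\<close>.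
\<close>

lemma leibniz_triangle_cofactors:
  fixes m x a l d n b :: real
  assumes "m * x * a = l" "m * (d * x / n) * b = l" "n = d + m" "m > 0" "d > 0"
  shows "l = d * x * (b - a)"
proof -
  have "m * d * x * b = l * (d + m)"
    using assms(2-5) by (simp add: field_simps)
  then have "m * (d * x * (b - a)) = l * (d + m) - d * (m * x * a)"
    by (simp add: algebra_simps)
  also have "\<dots> = m * l" unfolding assms(1) by (simp add: algebra_simps)
  finally show ?thesis using \<open>m > 0\<close> by simp
qed

text \<open>Induction on \<open>m\<close>: if two neighbouring entries of the Leibniz triangle
  become integers on multiplication by \<open>Lcm {1..n}\<close>, so does their difference, which is
  the next entry. Applied to the central binomial coefficient, this bounds an lcm from
  below.\<close>

lemma mult_binomial_dvd_Lcm: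
  fixes m n :: nat
  assumes "0 < m" "m \<le> n"
  shows "m * (n choose m) dvd Lcm {1..n}"
  using assms
proof (induction m arbitrary: n rule: nat_induct_non_zero)
  case 1
  then show ?case by (auto intro: dvd_Lcm)
next
  case (Suc m)
  define k where "k = n - Suc m"
  have n: "n = Suc (m + k)" using Suc.prems by (simp add: k_def)
  let ?L = "Lcm {1..n}"
  have A: "m * (n choose m) dvd ?L" using Suc n by simp
  have "m * ((n - 1) choose m) dvd Lcm {1..n - 1}" using Suc n by simp
  also have "\<dots> dvd ?L" by (rule Lcm_subset) auto
  finally have B: "m * ((n - 1) choose m) dvd ?L" .
  let ?x = "real (n choose m)"
  have x: "?x > 0" using n by simp
  have "(n - m) * (n choose m) = n * ((n - 1) choose m)"
    using n binomial_absorb_comp[of n m] by simp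
  then have Bx: "real (n - m) * ?x = real n * real ((n - 1) choose m)"
    by (metis of_nat_mult)
  have "Suc m * (n choose Suc m) = (n - m) * (n choose m)"
    by (metis binomial_absorb_comp binomial_absorption mult.commute)
  then have Dx: "real (Suc m * (n choose Suc m)) = real (n - m) * ?x"
    by (metis of_nat_mult)
  have y: "real ((n - 1) choose m) = real (n - m) * ?x / real n"
    using Bx n by (simp add: field_simps)
  obtain a where a: "?L = m * (n choose m) * a" using A by blast
  obtain b where b: "?L = m * ((n - 1) choose m) * b" using B by blast
  \<comment> \<open>The cofactor of the new divisor is \<open>b - a\<close>. The identity involves a
    division by \<open>n\<close>, so it is proved over the reals and then moved to the integers,
    since subtraction on \<open>nat\<close> would truncate.\<close>
  have "real ?L = real (Suc m * (n choose Suc m)) * (real b - real a)"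
  proof -
    have "real m * ?x * real a = real ?L" by (simp only: a of_nat_mult)
    moreover have "real m * (real (n - m) * ?x / real n) * real b = real ?L"
      by (simp only: b of_nat_mult y)
    ultimately show ?thesis
      using leibniz_triangle_cofactors[of "real m" ?x "real a" "real ?L" "real (n - m)" "real n" "real b"]
        n x \<open>0 < m\<close> unfolding Dx by simp
  qed
  then have "real_of_int (int ?L) = of_int (int (Suc m * (n choose Suc m)) * (int b - int a))"
    by (simp only: of_int_mult of_int_diff of_int_of_nat_eq)
  then have "int ?L = int (Suc m * (n choose Suc m)) * (int b - int a)"
    by (simp only: of_int_eq_iff)
  then have "int (Suc m * (n choose Suc m)) dvd int ?L"
    by (rule dvdI)
  then show ?case by (simp only: int_dvd_int_iff)
qed

text \<open>The multiplicity of \<open>p\<close> in an lcm is the maximum over the members, and some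
  member attains it. The condition \<open>0 \<notin> A\<close> keeps the lcm nonzero, and
  \<open>k > 0\<close> excludes \<open>A = {}\<close>, whose lcm is 1.\<close>

lemma prime_power_dvd_Lcm_nat:
  fixes p k :: nat
  assumes "prime p" "finite A" "0 \<notin> A" "p ^ k dvd Lcm A" "k > 0"
  shows "\<exists>a\<in>A. p ^ k dvd a"
  using assms(2,3,4)
proof (induction A rule: finite_induct)
  case empty
  then show ?case using assms(1,5) by (auto simp: prime_nat_iff)
next
  case (insert a A)
  have nz: "a \<noteq> 0" "Lcm A \<noteq> 0" using insert by (auto simp: Lcm_0_iff)
  have "k \<le> multiplicity p (lcm a (Lcm A))"
    using insert.prems nz assms(1)
    by (intro multiplicity_geI) (auto simp: prime_nat_iff)
  also have "\<dots> = max (multiplicity p a) (multiplicity p (Lcm A))"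
    using nz assms(1) by (simp add: multiplicity_lcm)
  finally have "p ^ k dvd a \<or> p ^ k dvd Lcm A"
    by (auto simp: le_max_iff_disj intro: multiplicity_dvd')
  then show ?case using insert by auto
qed

text \<open>Each maximal prime power in the lcm already divides some number in
  \<open>{1..n}\<close>, hence is at most \<open>n\<close>, and only primes up to \<open>n\<close>
  occur.\<close>

lemma Lcm_atMost_le:
  fixes n :: nat
  shows "Lcm {1..n} \<le> n ^ card {p. prime p \<and> p \<le> n}"
proof (cases "n = 0")
  case False
  define L where "L = Lcm {1..n}"
  have fin: "finite {p. prime p \<and> p \<le> n}" by (rule finite_subset[of _ "{..n}"]) auto
  have L: "L \<noteq> 0" by (auto simp: L_def Lcm_0_iff)
  have le: "p ^ multiplicity p L \<le> n \<and> p \<le> n" if p: "p \<in> prime_factors L" for p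
  proof -
    have "multiplicity p L > 0" "prime p" using p by (auto simp: prime_factors_multiplicity)
    then obtain a where a: "a \<in> {1..n}" "p ^ multiplicity p L dvd a"
      using prime_power_dvd_Lcm_nat[of p "{1..n}" "multiplicity p L"] multiplicity_dvd[of p L]
      unfolding L_def by auto
    moreover have "p dvd p ^ multiplicity p L" using \<open>multiplicity p L > 0\<close> by simp
    ultimately show ?thesis
      by (metis atLeastAtMost_iff dvd_imp_le dvd_trans le_trans less_le_trans zero_less_one)
  qed
  have "L = (\<Prod>p\<in>prime_factors L. p ^ multiplicity p L)"
    using L by (simp add: prod_prime_factors)
  also have "\<dots> \<le> (\<Prod>p\<in>prime_factors L. n)" using le by (intro prod_mono) auto
  also have "\<dots> = n ^ card (prime_factors L)" by simp
  also have "\<dots> \<le> n ^ card {p. prime p \<and> p \<le> n}"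
    using False le fin by (intro power_increasing card_mono subsetI) auto
  finally show ?thesis unfolding L_def .
next
  case True
  then have "{p. prime p \<and> p \<le> n} = {}"
    by (metis (mono_tags, lifting) bot_nat_0.extremum_uniqueI empty_Collect_eq not_prime_0)
  with True show ?thesis by (simp only: card.empty) simp
qed

text \<open>The logarithm of \<open>4 ^ n / (2 * n) \<le> (2 * n) choose n \<le> Lcm {1..2 * n}
  \<le> (2 * n) ^ ?k\<close>. The \<open>+ 1\<close> comes from the denominator
  \<open>2 * n\<close>.\<close>

lemma prime_count_lower_bound:
  fixes n :: nat
  assumes "n > 0"
  shows "real n * ln 4 \<le> (real (card {p. prime p \<and> p \<le> 2 * n}) + 1) * ln (2 * real n)"
proof -
  let ?k = "card {p. prime p \<and> p \<le> 2 * n}"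
  have "4 ^ n / (2 * real n) \<le> real ((2 * n) choose n)"
    using assms central_binomial_lower_bound[of n] by simp
  also have "real ((2 * n) choose n) \<le> real ((2 * n) ^ ?k)"
    unfolding of_nat_le_iff
  proof -
    have "(2 * n) choose n \<le> n * ((2 * n) choose n)" using assms by simp
    also have "n * ((2 * n) choose n) dvd Lcm {1..2 * n}"
      using assms by (intro mult_binomial_dvd_Lcm) auto
    then have "n * ((2 * n) choose n) \<le> Lcm {1..2 * n}"
      by (rule dvd_imp_le) (rule Nat.gr0I, simp add: Lcm_0_iff)
    also have "\<dots> \<le> (2 * n) ^ ?k" by (rule Lcm_atMost_le)
    finally show "(2 * n) choose n \<le> (2 * n) ^ ?k" .
  qed
  finally have "4 ^ n \<le> (2 * real n) ^ (?k + 1)"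
    using assms by (simp add: field_simps)
  then have "ln ((4::real) ^ n) \<le> ln ((2 * real n) ^ (?k + 1))"
    using assms by (subst ln_le_cancel_iff) auto
  then show ?thesis using assms by (simp add: ln_realpow ln_mult algebra_simps)
qed

text \<open>The Legendre symbol lemmas below require \<open>p > 2\<close>. The cut-off is real
  because it will be a real power of \<open>N\<close>.\<close>

definition odd_primes_upto :: "real \<Rightarrow> nat set" where
  "odd_primes_upto x = {p. prime p \<and> 2 < p \<and> real p \<le> x}"

lemma finite_odd_primes_upto [simp]: "finite (odd_primes_upto x)"
  by (rule finite_subset[of _ "{..nat \<lfloor>x\<rfloor>}"]) (auto simp: odd_primes_upto_def le_nat_floor)

text \<open>Of the 2 subtracted, one accounts for the omitted prime 2 and one for the
  \<open>+ 1\<close> in \<open>prime_count_lower_bound\<close>.\<close>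

lemma card_odd_primes_upto_ge:
  assumes "x \<ge> 2"
  shows "(x / 2 - 1) * ln 4 / ln x - 2 \<le> real (card (odd_primes_upto x))"
proof -
  define n where "n = nat \<lfloor>x / 2\<rfloor>"
  have n: "n > 0" "real n \<le> x / 2" "x / 2 - 1 \<le> real n"
    using assms by (auto simp: n_def) linarith+
  let ?P = "{p. prime p \<and> p \<le> 2 * n}"
  have "?P \<subseteq> insert 2 (odd_primes_upto x)"
  proof
    fix p assume "p \<in> ?P"
    then have "prime p" "real p \<le> x" "p \<ge> 2" using n by (auto dest: prime_ge_2_nat)
    then show "p \<in> insert 2 (odd_primes_upto x)" by (auto simp: odd_primes_upto_def)
  qed
  then have "card ?P \<le> card (insert 2 (odd_primes_upto x))" by (intro card_mono) auto
  also have "\<dots> \<le> Suc (card (odd_primes_upto x))" by (rule card_insert_le_m1) auto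
  finally have P: "real (card ?P) \<le> real (card (odd_primes_upto x)) + 1" by simp
  have "(x / 2 - 1) * ln 4 \<le> real n * ln 4" using n by (intro mult_right_mono) auto
  also have "\<dots> \<le> (real (card ?P) + 1) * ln (2 * real n)"
    by (rule prime_count_lower_bound) fact
  also have "\<dots> \<le> (real (card (odd_primes_upto x)) + 2) * ln x"
    using n P assms by (intro mult_mono) auto
  finally show ?thesis using assms by (simp add: field_simps)
qed

text \<open>The order x / ln x beats every power below the first. Later \<delta> = 1/2 suffices to
  beat logarithms, while a small \<delta> gives the final exponent.\<close>

lemma eventually_card_odd_primes_upto_ge:
  assumes "\<delta> > 0"
  shows "\<forall>\<^sub>F x in at_top. x powr (1 - \<delta>) \<le> real (card (odd_primes_upto x))"
proof -
  have "\<forall>\<^sub>F x in at_top. x powr (1 - \<delta>) \<le> (x / 2 - 1) * ln 4 / ln x - (2::real)"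
    using assms by real_asymp
  with eventually_ge_at_top[of 2] show ?thesis
    by eventually_elim (use card_odd_primes_upto_ge in force)
qed

lemma card_prime_divisors_le_log:
  fixes a :: nat
  assumes "a > 0"
  shows "real (card {p. prime p \<and> p dvd a}) \<le> log 2 (real a)"
proof -
  have "2 ^ card (prime_factors a) \<le> (\<Prod>p\<in>prime_factors a. p)"
    using prime_ge_2_nat by (subst prod_constant[symmetric], intro prod_mono) auto
  also have "\<dots> \<le> (\<Prod>p\<in>prime_factors a. p ^ multiplicity p a)"
    by (intro prod_mono) (auto simp: prime_factors_multiplicity prime_gt_0_nat intro!: self_le_power Suc_leI)
  also have "\<dots> = a" using assms by (simp add: prod_prime_factors)
  finally have "2 ^ card (prime_factors a) \<le> real a"
    by (metis of_nat_le_iff of_nat_numeral of_nat_power)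
  moreover have "prime_factors a = {p. prime p \<and> p dvd a}"
    using assms by (auto simp: prime_factors_dvd)
  ultimately show ?thesis
    using assms by (simp add: le_log_iff powr_realpow)
qed

subsection \<open>Legendre symbols and the square sieve\<close>

lemma Legendre_cong:
  assumes "[a = b] (mod p)"
  shows "Legendre a p = Legendre b p"
proof -
  have "[a = 0] (mod p) \<longleftrightarrow> [b = 0] (mod p)" "QuadRes p a \<longleftrightarrow> QuadRes p b"
    using assms unfolding QuadRes_def by (meson cong_sym cong_trans)+
  then show ?thesis by (simp add: Legendre_def)
qed

lemma Legendre_values: "Legendre a p \<in> {-1, 0, 1}"
  by (simp add: Legendre_def)

text \<open>Euler's criterion gives the identity modulo \<open>p\<close>. Both sides lie in {-1, 0,
  1}, so they differ by at most 2 < \<open>p\<close>.\<close>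

lemma Legendre_mult:
  fixes p :: nat
  assumes "prime p" "p > 2"
  shows "Legendre (a * b) p = Legendre a p * Legendre b p"
proof -
  let ?e = "(p - 1) div 2"
  have "[Legendre (a * b) p = (a * b) ^ ?e] (mod p)" by (rule euler_criterion) fact+
  also have "(a * b) ^ ?e = a ^ ?e * b ^ ?e" by (rule power_mult_distrib)
  also have "[a ^ ?e * b ^ ?e = Legendre a p * Legendre b p] (mod p)"
    by (intro cong_mult; rule cong_sym, rule euler_criterion; fact)
  finally have "int p dvd Legendre (a * b) p - Legendre a p * Legendre b p"
    by (simp add: cong_iff_dvd_diff)
  moreover have "\<bar>Legendre (a * b) p - Legendre a p * Legendre b p\<bar> < int p"
    using Legendre_values[of "a * b" p] Legendre_values[of a p] Legendre_values[of b p] assms by auto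
  ultimately show ?thesis
    using dvd_imp_le_int[of "Legendre (a * b) p - Legendre a p * Legendre b p" "int p"] by fastforce
qed

lemma Legendre_eq_0_iff: "Legendre a p = 0 \<longleftrightarrow> p dvd a"
  by (simp add: Legendre_def cong_0_iff)

lemma Legendre_square: "Legendre (a\<^sup>2) p = (if p dvd a\<^sup>2 then 0 else 1)"
proof -
  have "QuadRes p (a\<^sup>2)" unfolding QuadRes_def by (rule exI[of _ a]) simp
  then show ?thesis by (simp add: Legendre_def cong_0_iff)
qed

text \<open>Otherwise squaring would be surjective, hence injective, on the finite set of residues
  modulo \<open>p\<close>; but 1 and \<open>p - 1\<close> have the same square and are distinct for
  \<open>p > 2\<close>.\<close>

lemma ex_Legendre_eq_minus_1:
  fixes p :: nat
  assumes "prime p" "p > 2"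
  shows "\<exists>a. Legendre a p = -1"
proof (rule ccontr)
  assume "\<not> ?thesis"
  then have res: "QuadRes p a" if "\<not> int p dvd a" for a
    using that by (auto simp: Legendre_def cong_0_iff split: if_splits)
  let ?S = "{0..<int p}" and ?f = "\<lambda>x. x\<^sup>2 mod int p"
  have "?S \<subseteq> ?f ` ?S"
  proof
    fix a assume a: "a \<in> ?S"
    have "QuadRes p a"
    proof (cases "int p dvd a")
      case True
      then have "[0\<^sup>2 = a] (mod int p)" by (simp add: cong_sym_eq[of 0] cong_0_iff)
      then show ?thesis unfolding QuadRes_def by blast
    qed (rule res)
    then obtain y where "[y\<^sup>2 = a] (mod p)" by (auto simp: QuadRes_def)
    moreover have "a mod int p = a" using a by simp
    ultimately have "?f (y mod int p) = a" by (simp add: Cong.cong_def power_mod)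
    moreover have "y mod int p \<in> ?S" using assms by simp
    ultimately show "a \<in> ?f ` ?S" by blast
  qed
  then have "inj_on ?f ?S"
    by (rule finite_surj_inj[rotated]) simp
  moreover have "?f 1 = ?f (int p - 1)"
  proof -
    have "(int p - 1)\<^sup>2 = 1 + int p * (int p - 2)" by (simp add: power2_eq_square algebra_simps)
    then show ?thesis by simp
  qed
  ultimately have "1 = int p - 1" by (rule inj_onD) (use assms in auto)
  then show False using assms by simp
qed

section \<open>Primitivity of the Legendre symbol and of products of two of them\<close>

lemma primitive_dirichlet_characterI:
  assumes "dirichlet_character q \<chi>"
    and "\<And>d. d dvd q \<Longrightarrow> d < q \<Longrightarrow> \<exists>a. coprime a (int q) \<and> [a = 1] (mod int d) \<and> \<chi> a \<noteq> \<chi> 1"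
  shows "primitive_dirichlet_character q \<chi>"
  unfolding primitive_dirichlet_character_def
proof (intro conjI notI)
  assume "\<exists>d<q. induced_from d q \<chi>"
  then obtain d \<psi> where d: "d < q" "d dvd q" "dirichlet_character d \<psi>"
    and \<psi>: "\<And>a. coprime a (int q) \<Longrightarrow> \<chi> a = \<psi> a"
    by (auto simp: induced_from_def)
  from assms(2)[OF d(2,1)] obtain a
    where a: "coprime a (int q)" "[a = 1] (mod int d)" "\<chi> a \<noteq> \<chi> 1" by blast
  \<comment> \<open>On residues coprime to \<open>q\<close>, a character induced from
    \<open>d\<close> depends only on the class modulo \<open>d\<close>, which is the same for
    \<open>a\<close> and 1.\<close>
  have "\<psi> a = \<psi> 1" using a(2) d(3) by (auto simp: dirichlet_character_def)
  then show False using a \<psi>[of a] \<psi>[of 1] by simp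
qed fact

lemma coprime_prime_int_iff:
  fixes p :: nat and a :: int
  assumes "prime p"
  shows "coprime a (int p) \<longleftrightarrow> \<not> int p dvd a"
proof
  assume "coprime a (int p)"
  then show "\<not> int p dvd a"
    using assms by (metis coprime_common_divisor dvd_refl not_prime_unit prime_nat_int_transfer)
next
  assume "\<not> int p dvd a"
  then have "coprime (int p) a" using assms by (intro prime_imp_coprime) auto
  then show "coprime a (int p)" by (simp add: coprime_commute)
qed

lemma Legendre_dirichlet_character:
  fixes p :: nat
  assumes "prime p" "p > 2"
  shows "dirichlet_character p (\<lambda>a. of_int (Legendre a p))"
  unfolding dirichlet_character_def
  using assms by (auto simp: Legendre_mult Legendre_eq_0_iff coprime_prime_int_iff dest: Legendre_cong)

lemma Legendre_1: "prime p \<Longrightarrow> Legendre 1 (int p) = 1"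
  using Legendre_square[of 1 p] by (auto simp: prime_nat_iff)

text \<open>The only proper divisor of \<open>p\<close> is 1, and congruence modulo 1 is vacuous, so
  any nonresidue is a witness.\<close>

lemma Legendre_primitive:
  fixes p :: nat
  assumes "prime p" "p > 2"
  shows "primitive_dirichlet_character p (\<lambda>a. of_int (Legendre a p))"
proof (rule primitive_dirichlet_characterI[OF Legendre_dirichlet_character[OF assms]])
  fix d assume "d dvd p" "d < p"
  then have "d = 1" using assms(1) by (auto simp: prime_nat_iff)
  obtain a where a: "Legendre a p = -1" using ex_Legendre_eq_minus_1 assms by blast
  then have "coprime a (int p)" using Legendre_eq_0_iff[of a p] assms by (simp add: coprime_prime_int_iff)
  then show "\<exists>a. coprime a (int p) \<and> [a = 1] (mod int d) \<and>
      complex_of_int (Legendre a p) \<noteq> of_int (Legendre 1 p)"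
    using a \<open>d = 1\<close> assms by (intro exI[of _ a]) (auto simp: Legendre_1)
qed

lemma dirichlet_character_mult:
  assumes "dirichlet_character p \<chi>" "dirichlet_character q \<psi>"
  shows "dirichlet_character (p * q) (\<lambda>a. \<chi> a * \<psi> a)"
  unfolding dirichlet_character_def
proof (intro conjI allI impI)
  fix a b assume "[a = b] (mod int (p * q))"
  then have "[a = b] (mod int p)" "[a = b] (mod int q)"
    by (auto elim: cong_dvd_modulus)
  then show "\<chi> a * \<psi> a = \<chi> b * \<psi> b"
    using assms by (simp add: dirichlet_character_def)
qed (use assms in \<open>auto simp: dirichlet_character_def\<close>)

lemma dvd_mult_primes_cases:
  fixes p q d :: nat
  assumes "prime p" "prime q" "d dvd p * q" "d < p * q"
  shows "d dvd p \<or> d dvd q"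
proof -
  obtain x y where d: "d = x * y" "x dvd p" "y dvd q"
    using division_decomp[OF assms(3)] by blast
  then have "x = 1 \<or> x = p" "y = 1 \<or> y = q" using assms(1,2) by (auto simp: prime_nat_iff)
  then show ?thesis using d assms(4) by auto
qed

text \<open>By the Chinese remainder theorem, \<open>a\<close> can be 1 modulo \<open>p\<close> and
  a nonresidue modulo \<open>q\<close>.\<close>

lemma ex_Legendre_product_eq_minus_1:
  fixes p q :: nat
  assumes "prime p" "prime q" "q > 2" "p \<noteq> q"
  shows "\<exists>a. [a = 1] (mod int p) \<and> coprime a (int (p * q)) \<and> Legendre a p * Legendre a q = -1"
proof -
  obtain b where b: "Legendre b q = -1" using ex_Legendre_eq_minus_1 assms by blast
  have "coprime (int p) (int q)" using assms by (simp add: primes_coprime)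
  then obtain a where a: "[a = 1] (mod int p)" "[a = b] (mod int q)"
    using binary_chinese_remainder_int by blast
  have "Legendre a p = 1" using Legendre_cong[OF a(1)] assms by (simp add: Legendre_1)
  moreover have "Legendre a q = -1" using Legendre_cong[OF a(2)] b by simp
  moreover have "coprime a (int p)" "coprime a (int q)"
    using Legendre_eq_0_iff[of a p] Legendre_eq_0_iff[of a q] assms calculation
    by (auto simp: coprime_prime_int_iff)
  ultimately show ?thesis using a by (intro exI[of _ a]) auto
qed

lemma Legendre_product_primitive:
  fixes p q :: nat
  assumes "prime p" "p > 2" "prime q" "q > 2" "p \<noteq> q"
  shows "primitive_dirichlet_character (p * q) (\<lambda>a. of_int (Legendre a p) * of_int (Legendre a q))"
proof (rule primitive_dirichlet_characterI)
  show "dirichlet_character (p * q) (\<lambda>a. of_int (Legendre a p) * of_int (Legendre a q))"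
    by (intro dirichlet_character_mult Legendre_dirichlet_character assms)
next
  fix d assume "d dvd p * q" "d < p * q"
  \<comment> \<open>A proper divisor misses one of the two primes; the witness is a nonresidue
    modulo the missed prime and 1 modulo the other.\<close>
  then have "d dvd p \<or> d dvd q" using dvd_mult_primes_cases assms by blast
  then obtain a where a: "[a = 1] (mod int d)" "coprime a (int (p * q))"
      "Legendre a p * Legendre a q = -1"
  proof
    assume "d dvd p"
    with ex_Legendre_product_eq_minus_1[of p q] assms show ?thesis
      by (metis that cong_dvd_modulus int_dvd_int_iff)
  next
    assume "d dvd q"
    with ex_Legendre_product_eq_minus_1[of q p] assms show ?thesis
      by (metis that cong_dvd_modulus int_dvd_int_iff mult.commute)
  qed
  have "complex_of_int (Legendre a p) * of_int (Legendre a q) = of_int (-1)"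
    by (simp only: a(3) flip: of_int_mult)
  then show "\<exists>a. coprime a (int (p * q)) \<and> [a = 1] (mod int d) \<and>
      complex_of_int (Legendre a p) * of_int (Legendre a q) \<noteq>
      of_int (Legendre 1 p) * of_int (Legendre 1 q)"
    using a assms by (intro exI[of _ a]) (auto simp: Legendre_1)
qed

section \<open>The square sieve inequality\<close>

lemma abs_Legendre_le_1: "\<bar>Legendre a p\<bar> \<le> 1"
  by (simp add: Legendre_def)

text \<open>Since \<open>s * (s * m\<^sup>2)\<close> is the square of \<open>s * m\<close>, every
  symbol is 1 except at primes dividing \<open>s * m\<close>, and these are at most half of
  \<open>P\<close>.\<close>

lemma sum_Legendre_square_multiple:
  fixes P :: "nat set"
  assumes "finite P" "\<And>p. p \<in> P \<Longrightarrow> prime p"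
    and "2 * card {p \<in> P. int p dvd s * m} \<le> card P"
  shows "real (card P) \<le> 2 * real_of_int (\<Sum>p\<in>P. Legendre (s * (s * m\<^sup>2)) p)"
proof -
  let ?Z = "{p \<in> P. int p dvd s * m}"
  have "Legendre (s * (s * m\<^sup>2)) p = (if int p dvd s * m then 0 else 1)" if "p \<in> P" for p
  proof -
    have "s * (s * m\<^sup>2) = (s * m)\<^sup>2" by (simp add: power2_eq_square)
    moreover have "int p dvd (s * m)\<^sup>2 \<longleftrightarrow> int p dvd s * m"
      using assms(2)[OF that] by (simp add: prime_dvd_power_iff)
    ultimately show ?thesis by (simp only: Legendre_square)
  qed
  then have "(\<Sum>p\<in>P. Legendre (s * (s * m\<^sup>2)) p) = (\<Sum>p\<in>P. if int p dvd s * m then 0 else 1)"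
    by (intro sum.cong) auto
  also have "\<dots> = int (card (P - ?Z))"
    using assms(1) by (subst sum.If_cases) (auto simp: set_diff_eq Int_def intro!: arg_cong[where f = card])
  also have "card (P - ?Z) = card P - card ?Z" using assms(1) by (intro card_Diff_subset) auto
  finally show ?thesis using assms(3) by simp
qed

text \<open>Each counted \<open>n\<close> contributes at least \<open>(card P)\<^sup>2\<close> to
  the sum of \<open>(2 * f n)\<^sup>2\<close>; the sum over all of \<open>D\<close> is then expanded
  into correlations of pairs of symbols.\<close>

lemma square_sieve:
  fixes P :: "nat set" and D :: "'a set" and a :: "'a \<Rightarrow> int" and s :: int and B :: real
  assumes fin: "finite D" "finite P"
    and P: "\<And>p. p \<in> P \<Longrightarrow> prime p \<and> 2 < p"
    and B: "\<And>p q. p \<in> P \<Longrightarrow> q \<in> P \<Longrightarrow> p \<noteq> q \<Longrightarrow>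
              \<bar>real_of_int (\<Sum>n\<in>D. Legendre (a n) p * Legendre (a n) q)\<bar> \<le> B"
    and "B \<ge> 0"
    and few: "\<And>n m. n \<in> D \<Longrightarrow> a n = s * m\<^sup>2 \<Longrightarrow> 2 * card {p \<in> P. int p dvd s * m} \<le> card P"
  shows "real (card {n \<in> D. \<exists>m. a n = s * m\<^sup>2}) * (real (card P))\<^sup>2
           \<le> 4 * (real (card P) * real (card D) + (real (card P))\<^sup>2 * B)"
proof -
  define f where "f n = (\<Sum>p\<in>P. Legendre (s * a n) (int p))" for n
  let ?A = "{n \<in> D. \<exists>m. a n = s * m\<^sup>2}"
  have "real (card ?A) * (real (card P))\<^sup>2 = (\<Sum>n\<in>?A. (real (card P))\<^sup>2)" by simp
  also have "\<dots> \<le> (\<Sum>n\<in>?A. (2 * real_of_int (f n))\<^sup>2)"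
  proof (intro sum_mono power_mono)
    fix n assume "n \<in> ?A"
    then obtain m where "n \<in> D" "a n = s * m\<^sup>2" by blast
    then show "real (card P) \<le> 2 * real_of_int (f n)"
      unfolding f_def using sum_Legendre_square_multiple[of P s m] fin P few by simp
  qed auto
  also have "\<dots> \<le> (\<Sum>n\<in>D. (2 * real_of_int (f n))\<^sup>2)" using fin by (intro sum_mono2) auto
  also have "\<dots> = 4 * real_of_int (\<Sum>n\<in>D. (f n)\<^sup>2)"
    by (simp add: power_mult_distrib sum_distrib_left)
  also have "(\<Sum>n\<in>D. (f n)\<^sup>2) = (\<Sum>n\<in>D. \<Sum>p\<in>P. \<Sum>q\<in>P. Legendre (s * a n) p * Legendre (s * a n) q)"
    by (simp add: f_def power2_eq_square sum_product)
  also have "\<dots> = (\<Sum>p\<in>P. \<Sum>q\<in>P. \<Sum>n\<in>D. Legendre (s * a n) p * Legendre (s * a n) q)"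
    by (subst sum.swap, intro sum.cong refl, rule sum.swap)
  \<comment> \<open>The diagonal is bounded trivially by \<open>card D\<close>. Allowing
    \<open>B\<close> there as well simplifies the double sum.\<close>
  also have "real_of_int \<dots> \<le> (\<Sum>p\<in>P. \<Sum>q\<in>P. (if p = q then real (card D) else 0) + B)"
    unfolding of_int_sum[of _ P]
  proof (intro sum_mono)
    fix p q assume pq: "p \<in> P" "q \<in> P"
    let ?S = "\<Sum>n\<in>D. Legendre (a n) p * Legendre (a n) q"
    \<comment> \<open>Multiplicativity pulls \<open>s\<close> out as a factor of absolute value at
      most 1, which makes the bound uniform in \<open>s\<close>.\<close>
    have "(\<Sum>n\<in>D. Legendre (s * a n) p * Legendre (s * a n) q) = (Legendre s p * Legendre s q) * ?S"
      using pq P by (simp add: Legendre_mult sum_distrib_left mult_ac)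
    also have "real_of_int \<dots> \<le> real_of_int (\<bar>Legendre s p\<bar> * \<bar>Legendre s q\<bar>) * \<bar>real_of_int ?S\<bar>"
      by (simp only: abs_ge_self flip: of_int_mult of_int_abs abs_mult mult.assoc)
    also have "\<dots> \<le> 1 * \<bar>real_of_int ?S\<bar>"
      using mult_mono[OF abs_Legendre_le_1[of s p] abs_Legendre_le_1[of s q]]
      by (intro mult_right_mono) (auto simp flip: of_int_mult of_int_abs)
    also have "\<dots> \<le> (if p = q then real (card D) else 0) + B"
    proof (cases "p = q")
      case True
      have "\<bar>?S\<bar> \<le> (\<Sum>n\<in>D. \<bar>Legendre (a n) p * Legendre (a n) q\<bar>)" by (rule sum_abs)
      also have "\<dots> \<le> (\<Sum>n\<in>D. 1 * 1)"
        unfolding abs_mult by (intro sum_mono mult_mono abs_Legendre_le_1) auto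
      finally have "\<bar>?S\<bar> \<le> int (card D)" by simp
      then have "\<bar>real_of_int ?S\<bar> \<le> real (card D)"
        by (metis of_int_abs of_int_le_iff of_int_of_nat_eq)
      then show ?thesis using True \<open>B \<ge> 0\<close> by simp
    qed (use B pq in simp)
    finally show "real_of_int (\<Sum>n\<in>D. Legendre (s * a n) p * Legendre (s * a n) q)
        \<le> (if p = q then real (card D) else 0) + B" .
  qed
  also have "\<dots> = real (card P) * real (card D) + (real (card P))\<^sup>2 * B"
    using fin by (simp add: sum.distrib power2_eq_square algebra_simps)
  finally show ?thesis by simp
qed

subsection \<open>Consequences of the power-saving hypothesis\<close>

text \<open>Stated with a real inequality to match the summation range of the hypothesis;
  \<open>upper_half_eq\<close> is the integer form.\<close>

definition upper_half :: "nat \<Rightarrow> nat set" where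
  "upper_half N = {n. real N / 2 < real n \<and> n \<le> N}"

lemma finite_upper_half [simp]: "finite (upper_half N)"
  by (rule finite_subset[of _ "{..N}"]) (auto simp: upper_half_def)

lemma upper_half_eq: "upper_half N = {N div 2<..N}"
  by (auto simp: upper_half_def)

lemma upper_half_Suc_double: "upper_half (Suc (2 * N)) = insert (Suc (2 * N)) (upper_half (2 * N))"
  by (auto simp: upper_half_eq)

lemma card_upper_half_le: "card (upper_half N) \<le> N"
  by (simp add: upper_half_eq)

lemma floor_powr_bounds:
  fixes c :: real
  assumes "c > 0" "n > 0"
  shows "0 < \<lfloor>real n powr c\<rfloor>" "real_of_int \<lfloor>real n powr c\<rfloor> \<le> real n powr c"
  using assms ge_one_powr_ge_zero[of "real n" c] by (auto simp: one_le_floor zero_less_floor)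

lemma card_prime_divisors_int_le_log:
  fixes x :: int
  assumes "x \<noteq> 0" "real_of_int \<bar>x\<bar> \<le> y" "\<And>p. p \<in> P \<Longrightarrow> prime p"
  shows "real (card {p \<in> P. int p dvd x}) \<le> log 2 y"
proof -
  have pos: "nat \<bar>x\<bar> > 0" using assms by simp
  have fin: "finite {p. prime p \<and> p dvd nat \<bar>x\<bar>}"
    by (rule finite_subset[OF _ finite_divisors_nat[OF pos]]) auto
  have "card {p \<in> P. int p dvd x} \<le> card {p. prime p \<and> p dvd nat \<bar>x\<bar>}"
    using assms(3) by (intro card_mono fin) auto
  then have "real (card {p \<in> P. int p dvd x}) \<le> log 2 (real (nat \<bar>x\<bar>))"
    using card_prime_divisors_le_log[OF pos] by linarith
  also have "\<dots> \<le> log 2 y" using assms pos by (subst log_le_cancel_iff) auto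
  finally show ?thesis .
qed

text \<open>Positivity of the floor forces \<open>m \<noteq> 0\<close>, so |s m| is at most s m^2,
  hence at most N^c; a positive integer of that size has at most c log2 N prime divisors.\<close>

lemma card_eq_square_multiple_le:
  fixes s :: nat and m :: int and c :: real
  assumes "c > 0" "n \<in> upper_half N" "\<lfloor>real n powr c\<rfloor> = int s * m\<^sup>2" "\<And>p. p \<in> P \<Longrightarrow> prime p"
  shows "real (card {p \<in> P. int p dvd int s * m}) \<le> c * log 2 (real N)"
proof -
  have n: "0 < n" "n \<le> N" using assms by (auto simp: upper_half_def)
  have pos: "0 < int s * m\<^sup>2" using floor_powr_bounds[OF assms(1) n(1)] assms(3) by simp
  have m: "m \<noteq> 0" "s \<noteq> 0" using pos by (auto intro!: Nat.gr0I)
  have "\<bar>int s * m\<bar> = int s * (\<bar>m\<bar> * 1)" by (simp add: abs_mult)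
  also have "\<dots> \<le> int s * (\<bar>m\<bar> * \<bar>m\<bar>)" using m by (intro mult_left_mono) auto
  also have "\<dots> = \<lfloor>real n powr c\<rfloor>" using assms(3) by (simp add: power2_eq_square)
  finally have "real_of_int \<bar>int s * m\<bar> \<le> real_of_int \<lfloor>real n powr c\<rfloor>" by (simp only: of_int_le_iff)
  also have "\<dots> \<le> real n powr c" using floor_powr_bounds[OF assms(1) n(1)] by simp
  also have "\<dots> \<le> real N powr c" using n assms by (intro powr_mono2) auto
  finally have "real (card {p \<in> P. int p dvd int s * m}) \<le> log 2 (real N powr c)"
    using m assms(4) by (intro card_prime_divisors_int_le_log) auto
  then show ?thesis using n by (simp add: log_powr)
qed

section \<open>Bounds for Legendre symbol sums, and the restriction they put on \<beta>\<close>

locale power_saving_character_sums =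
  fixes c \<beta> K :: real
  assumes c_pos: "c > 0" and \<beta>_pos: "\<beta> > 0"
    and character_sum_bound:
      "\<And>N q \<chi>. N > 0 \<Longrightarrow> q > 1 \<Longrightarrow> primitive_dirichlet_character q \<chi> \<Longrightarrow>
        norm (\<Sum>n\<in>upper_half N. \<chi> \<lfloor>real n powr c\<rfloor>) \<le> K * real q powr (1/2) * real N powr (1 - \<beta>)"
begin

abbreviation a :: "nat \<Rightarrow> int" where "a n \<equiv> \<lfloor>real n powr c\<rfloor>"

lemma Legendre_sum_bound:
  assumes "p \<in> odd_primes_upto z" "N > 0"
  shows "\<bar>real_of_int (\<Sum>n\<in>upper_half N. Legendre (a n) p)\<bar> \<le> \<bar>K\<bar> * z powr (1/2) * real N powr (1 - \<beta>)"
proof -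
  have p: "prime p" "p > 2" "real p \<le> z" using assms by (auto simp: odd_primes_upto_def)
  have "\<bar>real_of_int (\<Sum>n\<in>upper_half N. Legendre (a n) p)\<bar> =
      norm (\<Sum>n\<in>upper_half N. complex_of_int (Legendre (a n) p))"
    by (simp only: norm_of_int flip: of_int_sum)
  also have "\<dots> \<le> K * real p powr (1/2) * real N powr (1 - \<beta>)"
    using p assms by (intro character_sum_bound Legendre_primitive) auto
  also have "\<dots> \<le> \<bar>K\<bar> * z powr (1/2) * real N powr (1 - \<beta>)"
    using p by (intro mult_right_mono mult_mono powr_mono2) auto
  finally show ?thesis .
qed

text \<open>The modulus \<open>p * q\<close> is at most \<open>z * z\<close>, so its square root
  costs a factor \<open>z\<close>. The sign of \<open>K\<close> is not prescribed, hence
  \<open>\<bar>K\<bar>\<close>.\<close>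

lemma Legendre_product_sum_bound:
  assumes "p \<in> odd_primes_upto z" "q \<in> odd_primes_upto z" "p \<noteq> q" "N > 0"
  shows "\<bar>real_of_int (\<Sum>n\<in>upper_half N. Legendre (a n) p * Legendre (a n) q)\<bar>
           \<le> \<bar>K\<bar> * z * real N powr (1 - \<beta>)"
proof -
  have pq: "prime p" "p > 2" "real p \<le> z" "prime q" "q > 2" "real q \<le> z"
    using assms by (auto simp: odd_primes_upto_def)
  have "\<bar>real_of_int (\<Sum>n\<in>upper_half N. Legendre (a n) p * Legendre (a n) q)\<bar> =
      norm (\<Sum>n\<in>upper_half N. complex_of_int (Legendre (a n) p) * complex_of_int (Legendre (a n) q))"
    by (simp only: norm_of_int flip: of_int_sum of_int_mult)
  also have "\<dots> \<le> K * real (p * q) powr (1/2) * real N powr (1 - \<beta>)"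
    using pq assms less_1_mult[of p q] by (intro character_sum_bound Legendre_product_primitive) auto
  also have "\<dots> \<le> \<bar>K\<bar> * (z * z) powr (1/2) * real N powr (1 - \<beta>)"
    using pq by (intro mult_right_mono mult_mono powr_mono2) (auto intro!: mult_mono)
  also have "(z * z) powr (1/2) = z" using pq by (simp add: powr_half_sqrt)
  finally show ?thesis .
qed

lemma \<beta>_le_1: "\<beta> \<le> 1"
proof (rule ccontr)
  assume "\<not> \<beta> \<le> 1"
  \<comment> \<open>With primes up to N^b, the sums are at most |K| N^(b/2) N^(-b), which tends to
    0.\<close>
  define b where "b = \<beta> - 1"
  have b: "b > 0" using \<open>\<not> \<beta> \<le> 1\<close> by (simp add: b_def)
  have "filterlim (\<lambda>N::nat. real N powr b) at_top sequentially" using b by real_asymp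
  from eventually_compose_filterlim[OF eventually_card_odd_primes_upto_ge[of "1/2"] this]
  have "\<forall>\<^sub>F N in sequentially. (real N powr b) powr (1 - 1/2) \<le> real (card (odd_primes_upto (real N powr b)))"
    by simp
  moreover have "\<forall>\<^sub>F N::nat in sequentially. c * log 2 (real (Suc (2 * N))) < (real N powr b) powr (1 - 1/2)"
    using b c_pos by real_asymp
  moreover have "\<forall>\<^sub>F N::nat in sequentially. \<bar>K\<bar> * (real N powr b) powr (1/2) * real N powr (-b) < 1"
    using b by real_asymp
  ultimately have "\<forall>\<^sub>F N::nat in sequentially. False"
    using eventually_gt_at_top[of 0]
  proof eventually_elim
    case (elim N)
    let ?z = "real N powr b" and ?n = "Suc (2 * N)"
    \<comment> \<open>An integer of absolute value below 1 vanishes. Covering all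
      \<open>M \<ge> N\<close> makes this available at both \<open>2 * N\<close> and
      \<open>2 * N + 1\<close>.\<close>
    have S0: "(\<Sum>n\<in>upper_half M. Legendre (a n) p) = 0" if "p \<in> odd_primes_upto ?z" "M \<ge> N" for p M
    proof -
      have "\<bar>real_of_int (\<Sum>n\<in>upper_half M. Legendre (a n) p)\<bar> \<le> \<bar>K\<bar> * ?z powr (1/2) * real M powr (1 - \<beta>)"
        using that elim by (intro Legendre_sum_bound) auto
      also have "\<dots> \<le> \<bar>K\<bar> * ?z powr (1/2) * real N powr (-b)"
        using that elim b by (intro mult_left_mono) (auto simp: b_def intro!: powr_mono2')
      also have "\<dots> < 1" by fact
      finally have "\<bar>\<Sum>n\<in>upper_half M. Legendre (a n) p\<bar> < 1"
        by (simp only: of_int_less_1_iff flip: of_int_abs)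
      then show ?thesis by simp
    qed
    have "int p dvd a ?n" if "p \<in> odd_primes_upto ?z" for p
    proof -
      \<comment> \<open>The ranges for \<open>2 * N\<close> and \<open>2 * N + 1\<close> have the
        same lower end, so the two sums differ in a single term.\<close>
      have "(\<Sum>n\<in>upper_half ?n. Legendre (a n) p) =
          Legendre (a ?n) p + (\<Sum>n\<in>upper_half (2 * N). Legendre (a n) p)"
        unfolding upper_half_Suc_double by (rule sum.insert) (auto simp: upper_half_def)
      then have "Legendre (a ?n) p = 0" using S0[OF that, of ?n] S0[OF that, of "2 * N"] by simp
      then show ?thesis by (simp only: Legendre_eq_0_iff)
    qed
    then have "card (odd_primes_upto ?z) = card {p \<in> odd_primes_upto ?z. int p dvd a ?n}"
      by (intro arg_cong[where f = card]) blast
    moreover have "real (card {p \<in> odd_primes_upto ?z. int p dvd a ?n}) \<le> log 2 (real ?n powr c)"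
    proof (rule card_prime_divisors_int_le_log)
      have "a ?n > 0" "real_of_int (a ?n) \<le> real ?n powr c"
        by (rule floor_powr_bounds[OF c_pos]; simp)+
      then show "a ?n \<noteq> 0" "real_of_int \<bar>a ?n\<bar> \<le> real ?n powr c" by linarith+
    qed (simp add: odd_primes_upto_def)
    moreover have "log 2 (real ?n powr c) = c * log 2 (real ?n)"
      by (simp add: log_powr)
    ultimately show False using elim by linarith
  qed
  then show False by simp
qed

section \<open>The count on one dyadic block, and summation over blocks\<close>

definition square_multiples :: "nat \<Rightarrow> nat \<Rightarrow> nat set" where
  "square_multiples s N = {n \<in> upper_half N. \<exists>m::int. a n = int s * m\<^sup>2}"

lemma card_square_multiples_le: "card (square_multiples s N) \<le> N"
proof -
  have "card (square_multiples s N) \<le> card (upper_half N)"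
    by (intro card_mono) (auto simp: square_multiples_def)
  then show ?thesis using card_upper_half_le[of N] by linarith
qed

text \<open>The choice z = N^(\<beta>/2) balances the diagonal N / z against the off-diagonal z
  N^(1-\<beta>). The quantifier over \<open>s\<close> stands inside \<open>eventually\<close>, so
  the threshold does not depend on \<open>s\<close>.\<close>

lemma eventually_card_square_multiples_le:
  assumes "\<epsilon> > 0"
  shows "\<forall>\<^sub>F N in sequentially. \<forall>s.
           real (card (square_multiples s N)) \<le> 4 * (1 + \<bar>K\<bar>) * real N powr (1 - \<beta> / 2 + \<epsilon>)"
proof -
  have lim: "filterlim (\<lambda>N::nat. real N powr (\<beta>/2)) at_top sequentially" using \<beta>_pos by real_asymp
  from eventually_compose_filterlim[OF eventually_card_odd_primes_upto_ge[of "1/2"] lim]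
  have "\<forall>\<^sub>F N in sequentially. (real N powr (\<beta>/2)) powr (1 - 1/2)
      \<le> real (card (odd_primes_upto (real N powr (\<beta>/2))))"
    by simp
  \<comment> \<open>The exponent is chosen so that the lower bound for the number of primes becomes
    N^(\<beta>/2 - \<epsilon>).\<close>
  moreover have "\<forall>\<^sub>F N in sequentially. (real N powr (\<beta>/2)) powr (1 - 2 * \<epsilon> / \<beta>)
      \<le> real (card (odd_primes_upto (real N powr (\<beta>/2))))"
    using assms \<beta>_pos by (intro eventually_compose_filterlim[OF eventually_card_odd_primes_upto_ge lim]) auto
  moreover have "\<forall>\<^sub>F N::nat in sequentially. 2 * (c * log 2 (real N)) \<le> (real N powr (\<beta>/2)) powr (1 - 1/2)"
    using c_pos \<beta>_pos by real_asymp
  ultimately show ?thesis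
    using eventually_gt_at_top[of 0]
  proof eventually_elim
    case (elim N)
    let ?z = "real N powr (\<beta>/2)"
    define P where "P = odd_primes_upto ?z"
    define B where "B = \<bar>K\<bar> * ?z * real N powr (1 - \<beta>)"
    show ?case
    proof
      fix s :: nat
      let ?A = "real (card (square_multiples s N))" and ?P = "real (card P)"
      have "0 < ?z powr (1 - 1/2)" using elim by simp
      then have P0: "?P > 0" using elim(1) unfolding P_def by linarith
      have few: "2 * card {p \<in> P. int p dvd int s * m} \<le> card P"
        if "n \<in> upper_half N" "a n = int s * m\<^sup>2" for n m
      proof -
        have "real (card {p \<in> P. int p dvd int s * m}) \<le> c * log 2 (real N)"
          using that c_pos by (intro card_eq_square_multiple_le) (auto simp: P_def odd_primes_upto_def)
        then have "2 * real (card {p \<in> P. int p dvd int s * m}) \<le> ?P"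
          using elim unfolding P_def by linarith
        then show ?thesis by linarith
      qed
      have "?A * ?P\<^sup>2 \<le> 4 * (?P * real (card (upper_half N)) + ?P\<^sup>2 * B)"
        unfolding square_multiples_def
      proof (rule square_sieve)
        show "\<bar>real_of_int (\<Sum>n\<in>upper_half N. Legendre (a n) p * Legendre (a n) q)\<bar> \<le> B"
          if "p \<in> P" "q \<in> P" "p \<noteq> q" for p q
          using that elim unfolding B_def P_def by (intro Legendre_product_sum_bound) auto
        show "prime p \<and> 2 < p" if "p \<in> P" for p
          using that by (simp add: P_def odd_primes_upto_def)
        show "finite P" by (simp add: P_def)
      qed (use few in \<open>auto simp: B_def\<close>)
      also have "\<dots> \<le> 4 * (?P * real N + ?P\<^sup>2 * B)"
        using card_upper_half_le[of N] by (intro mult_left_mono add_right_mono) auto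
      also have "\<dots> = (4 * (real N / ?P + B)) * ?P\<^sup>2"
        using P0 by (simp add: power2_eq_square field_simps)
      finally have "?A \<le> 4 * (real N / ?P + B)" using P0 by (simp only: mult_le_cancel_right) simp
      also have "real N / ?P \<le> real N / real N powr (\<beta>/2 - \<epsilon>)"
      proof (intro divide_left_mono)
        have "?z powr (1 - 2 * \<epsilon> / \<beta>) = real N powr (\<beta>/2 - \<epsilon>)"
        proof -
          have "\<beta> / 2 * (1 - 2 * \<epsilon> / \<beta>) = \<beta> / 2 - \<epsilon>"
            using \<beta>_pos by (simp add: right_diff_distrib)
          then show ?thesis by (simp only: powr_powr)
        qed
        then show "real N powr (\<beta>/2 - \<epsilon>) \<le> ?P" using elim unfolding P_def by simp
      qed (use P0 elim in auto)
      also have "\<dots> = real N powr (1 - \<beta>/2 + \<epsilon>)"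
        using elim powr_diff[of "real N" 1 "\<beta>/2 - \<epsilon>"] by (simp add: algebra_simps)
      also have "B \<le> \<bar>K\<bar> * real N powr (1 - \<beta>/2 + \<epsilon>)"
      proof -
        have "B = \<bar>K\<bar> * real N powr (1 - \<beta>/2)"
          unfolding B_def mult.assoc by (simp flip: powr_add)
        also have "\<dots> \<le> \<bar>K\<bar> * real N powr (1 - \<beta>/2 + \<epsilon>)"
          using assms elim by (intro mult_left_mono powr_mono) auto
        finally show ?thesis .
      qed
      finally show "?A \<le> 4 * (1 + \<bar>K\<bar>) * real N powr (1 - \<beta> / 2 + \<epsilon>)"
        by (simp add: algebra_simps)
    qed
  qed
qed

lemma card_square_multiples_bound:
  assumes "\<epsilon> > 0"
  shows "\<exists>B\<ge>0. \<forall>s N. N > 0 \<longrightarrow> real (card (square_multiples s N)) \<le> B * real N powr (1 - \<beta> / 2 + \<epsilon>)"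
proof -
  obtain N0 where N0: "\<And>N s. N \<ge> N0 \<Longrightarrow>
      real (card (square_multiples s N)) \<le> 4 * (1 + \<bar>K\<bar>) * real N powr (1 - \<beta> / 2 + \<epsilon>)"
    using eventually_card_square_multiples_le[OF assms] unfolding eventually_sequentially by blast
  let ?B = "4 * (1 + \<bar>K\<bar>) + real N0"
  have "real (card (square_multiples s N)) \<le> ?B * real N powr (1 - \<beta> / 2 + \<epsilon>)" if "N > 0" for s N
  proof (cases "N \<ge> N0")
    case True
    then show ?thesis using N0[OF True, of s] by (simp add: distrib_right add_increasing2)
  next
    case False
    have "real (card (square_multiples s N)) \<le> real N0 * 1"
      using card_square_multiples_le[of s N] False by simp
    \<comment> \<open>For \<open>N < N0\<close> the trivial count suffices: \<beta> \<le> 1 makes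
      the exponent positive, so the power of \<open>N\<close> is at least 1.\<close>
    also have "\<dots> \<le> ?B * real N powr (1 - \<beta> / 2 + \<epsilon>)"
      using that assms \<beta>_le_1 by (intro mult_mono ge_one_powr_ge_zero) auto
    finally show ?thesis .
  qed
  then show ?thesis by (intro exI[of _ ?B]) auto
qed

lemma Q_count_dyadic: "Q_count c s N = card (square_multiples s N) + Q_count c s (N div 2)"
proof -
  let ?E = "\<lambda>n. \<exists>m::int. a n = int s * m\<^sup>2"
  have "{n \<in> {1..N}. ?E n} = square_multiples s N \<union> {n \<in> {1..N div 2}. ?E n}"
    by (auto simp: square_multiples_def upper_half_eq)
  moreover have "square_multiples s N \<inter> {n \<in> {1..N div 2}. ?E n} = {}"
    by (auto simp: square_multiples_def upper_half_eq)
  ultimately show ?thesis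
    unfolding Q_count_def by (simp add: card_Un_disjoint square_multiples_def)
qed

lemma Q_count_bound:
  assumes "\<epsilon> > 0"
  shows "\<exists>C. \<forall>s N. N > 0 \<longrightarrow> real (Q_count c s N) \<le> C * real N powr (1 - \<beta> / 2 + \<epsilon>)"
proof -
  define \<gamma> where "\<gamma> = 1 - \<beta> / 2 + \<epsilon>"
  have \<gamma>: "\<gamma> > 0" using \<beta>_le_1 assms by (simp add: \<gamma>_def)
  obtain B where B: "B \<ge> 0" "\<And>s N. N > 0 \<Longrightarrow> real (card (square_multiples s N)) \<le> B * real N powr \<gamma>"
    using card_square_multiples_bound[OF assms] unfolding \<gamma>_def by blast
  define r where "r = (1 / 2 :: real) powr \<gamma>"
  have r: "r < 1" using \<gamma> powr_less_mono2[of \<gamma> "1/2" 1] by (simp add: r_def)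
  \<comment> \<open>The sum of the geometric series with ratio \<open>r\<close>. It solves
    \<open>B + C * r = C\<close>, which closes the induction; \<open>r < 1\<close> holds because
    \<gamma> > 0.\<close>
  define C where "C = B / (1 - r)"
  have C: "C \<ge> 0" "B + C * r = C" using B r by (auto simp: C_def field_simps)
  have "real (Q_count c s N) \<le> C * real N powr \<gamma>" for s N
  proof (induction N rule: less_induct)
    case (less N)
    show ?case
    proof (cases "N = 0")
      \<comment> \<open>Repeated halving ends at \<open>N = 0\<close>, where both sides vanish
        because \<open>0 powr \<gamma> = 0\<close>.\<close>
      case True
      then show ?thesis by (simp add: Q_count_def)
    next
      case False
      have "real (Q_count c s N) = real (card (square_multiples s N)) + real (Q_count c s (N div 2))"
        by (subst Q_count_dyadic) simp
      also have "\<dots> \<le> B * real N powr \<gamma> + C * real (N div 2) powr \<gamma>"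
        using B less False by (intro add_mono) auto
      also have "\<dots> \<le> B * real N powr \<gamma> + C * (1/2 * real N) powr \<gamma>"
        using C \<gamma> by (intro add_left_mono mult_left_mono powr_mono2) (auto simp: real_of_nat_div)
      also have "\<dots> = (B + C * r) * real N powr \<gamma>"
        unfolding r_def by (subst powr_mult) (auto simp: algebra_simps)
      finally show ?thesis using C by simp
    qed
  qed
  then show ?thesis unfolding \<gamma>_def by blast
qed

end

theorem theorem2p2:
  fixes c \<beta> :: real
  assumes "c > 2" and "c \<notin> \<nat>" and "\<beta> > 0"
    and "\<exists>K::real. \<forall>(N::nat) (q::nat) (\<chi>::int \<Rightarrow> complex).
           N > 0 \<longrightarrow> q > 1 \<longrightarrow> primitive_dirichlet_character q \<chi> \<longrightarrow>
           norm (\<Sum>n | real N / 2 < real n \<and> n \<le> N. \<chi> \<lfloor>real n powr c\<rfloor>)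
             \<le> K * real q powr (1/2) * real N powr (1 - \<beta>)"
  shows "\<forall>\<epsilon>>0. \<exists>C::real. \<forall>(s::nat) (N::nat). s > 0 \<longrightarrow> N > 0 \<longrightarrow>
           real (Q_count c s N) \<le> C * real N powr (1 - \<beta> / 2 + \<epsilon>)"
proof -
  from assms(4) obtain K where "power_saving_character_sums c \<beta> K"
    using assms(1,3) that unfolding power_saving_character_sums_def upper_half_def by auto
  then interpret power_saving_character_sums c \<beta> K .
  show ?thesis
  proof (intro allI impI)
    fix \<epsilon> :: real assume "\<epsilon> > 0"
    from Q_count_bound[OF this] obtain C
      where "\<forall>s N. N > 0 \<longrightarrow> real (Q_count c s N) \<le> C * real N powr (1 - \<beta> / 2 + \<epsilon>)" ..
    then show "\<exists>C. \<forall>s N. s > 0 \<longrightarrow> N > 0 \<longrightarrow> real (Q_count c s N) \<le> C * real N powr (1 - \<beta> / 2 + \<epsilon>)"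
      by (intro exI[of _ C]) simp
  qed
qed

end
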